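(* Let $f$ be the solution of the Blasius boundary value problem $$f'''(x)+f(x)f''(x)=0\ \text{ for } x\in(0,\infty),\qquad f(0)=0,\quad f'(0)=0,\quad\lim_{x\to+\infty}f'(x)=1.$$ Then $f''(0)=0.469600\pm0.000022$, i.e. $|f''(0)-0.469600|\le0.000022$.
   Context: It is known (Weyl) that this boundary value problem has a unique solution $f$, and that $f(x)=a^{-1/2}F(a^{-1/2}x)$, where $F$ solves $F'''+FF''=0$, $F(0)=F'(0)=0$, $F''(0)=1$ on $[0,\infty)$ and $a=\lim_{x\to\infty}F'(x)\in(0,\infty)$. *)

theory Defs
  imports Complex_Main
begin

text \<open>
  \<^term>\<open>f\<close> lives on \<^term>\<open>{0..} :: real set\<close>; \<^term>\<open>f1\<close>, \<^term>\<open>f2\<close>, \<^term>\<open>f3\<close> are its first three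
  derivatives. The first two are taken on the closed half line, hence one-sided at
  \<^term>\<open>0 :: real\<close>, so that \<open>f'(0)\<close> and \<open>f''(0)\<close> make sense; the third derivative is
  only required where the equation is imposed. No continuity of \<^term>\<open>f2\<close> at
  \<^term>\<open>0 :: real\<close> is assumed.
\<close>

definition blasius_bvp ::
  "(real \<Rightarrow> real) \<Rightarrow> (real \<Rightarrow> real) \<Rightarrow> (real \<Rightarrow> real) \<Rightarrow> (real \<Rightarrow> real) \<Rightarrow> bool"
where
  "blasius_bvp f f1 f2 f3 \<longleftrightarrow>
     (\<forall>x\<ge>0. (f has_real_derivative f1 x) (at x within {0..})) \<and>
     (\<forall>x\<ge>0. (f1 has_real_derivative f2 x) (at x within {0..})) \<and>
     (\<forall>x>0. (f2 has_real_derivative f3 x) (at x)) \<and>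
     (\<forall>x>0. f3 x + f x * f2 x = 0) \<and>
     f 0 = 0 \<and> f1 0 = 0 \<and> (f1 \<longlongrightarrow> 1) at_top"

end

theory Submission
  imports Defs "HOL-Analysis.Analysis"
begin

text \<open>
  On \<open>(0, \<infinity>)\<close> the equation gives \<open>f'' = C exp (- \<integral>f)\<close>, which forces \<open>f''\<close> to be continuous at
  \<open>0\<close> and positive. With \<open>c\<^sup>3 = f''(0)\<close> the function \<open>F(x) = f(x/c)/c\<close> then solves the initial
  value problem with \<open>F''(0) = 1\<close>, and \<open>F' \<longrightarrow> a = c\<^sup>-\<^sup>2\<close>, so \<open>f''(0) = a\<^sup>-\<^sup>3\<^sup>/\<^sup>2\<close> and it remains to
  enclose \<open>a\<close>. On \<open>[0, 4]\<close> we compare \<open>F\<close> with an explicit polynomial \<open>P\<close> of degree 23. Its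
  residual \<open>P''' + P P''\<close> is bounded by the sum of the absolute values of its Chebyshev
  coefficients, and an energy estimate turns this into bounds for \<open>F\<close>, \<open>F'\<close>, \<open>F''\<close> at \<open>4\<close>. Beyond
  \<open>4\<close>, \<open>F' + F''/F\<close> decreases and \<open>F' + 0.9 F''/F\<close> increases, both with limit \<open>a\<close>.
\<close>

section \<open>Monotonicity and one-sided derivatives on a closed half line\<close>

lemma at_within_Ici_interior: "a < x \<Longrightarrow> at x within {a..} = at x" for x :: real
  by (rule at_within_open_subset[of _ "{a<..}"]) auto

text \<open>At \<open>a\<close> the derivative is only one-sided, so the mean value argument uses
  the open interval and continuity at its ends. Keeping \<open>a\<close> apart from \<open>b\<close>
  lets one family of derivatives serve every starting point.\<close>

lemma halfline_mono:
  fixes h h' :: "real \<Rightarrow> real"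
  assumes D: "\<And>x. a \<le> x \<Longrightarrow> (h has_real_derivative h' x) (at x within {a..})"
    and nonneg: "\<And>x. a < x \<Longrightarrow> x < y \<Longrightarrow> h' x \<ge> 0"
    and "a \<le> b" "b \<le> y"
  shows "h b \<le> h y"
proof (rule DERIV_nonneg_imp_increasing_open [OF \<open>b \<le> y\<close>])
  fix x assume "b < x" "x < y"
  then have "at x within {a..} = at x" using \<open>a \<le> b\<close> by (simp add: at_within_Ici_interior)
  then show "\<exists>z. (h has_real_derivative z) (at x) \<and> 0 \<le> z"
    using D[of x] nonneg[of x] \<open>b < x\<close> \<open>x < y\<close> \<open>a \<le> b\<close> by (intro exI[of _ "h' x"]) auto
next
  have "continuous_on {a..} h"
    using D by (intro DERIV_continuous_on) auto
  then show "continuous_on {b..y} h"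
    by (rule continuous_on_subset) (use \<open>a \<le> b\<close> in auto)
qed

text \<open>By the mean value theorem the difference quotient at \<open>a\<close> is
  \<open>h'\<close> at a point between \<open>a\<close> and \<open>x\<close>, which tends to
  \<open>a\<close> along with \<open>x\<close>.\<close>

lemma DERIV_right_limit_eq:
  fixes h h' :: "real \<Rightarrow> real"
  assumes D: "\<And>x. a \<le> x \<Longrightarrow> (h has_real_derivative h' x) (at x within {a..})"
    and lim: "(h' \<longlongrightarrow> L) (at_right a)"
  shows "h' a = L"
proof -
  have cont: "continuous_on {a..} h"
    using D by (intro DERIV_continuous_on) auto
  have "\<exists>z. a < z \<and> z < x \<and> h x - h a = (x - a) * h' z" if "a < x" for x
  proof -
    have DERIV: "(h has_real_derivative h' z) (at z)" if "a < z" for z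
      using D[of z] that by (simp add: at_within_Ici_interior)
    obtain l z where "a < z" "z < x" "(h has_real_derivative l) (at z)" "h x - h a = (x - a) * l"
      using MVT[OF \<open>a < x\<close> continuous_on_subset[OF cont]] DERIV real_differentiable_def by force
    then show ?thesis using DERIV DERIV_unique by blast
  qed
  then obtain z where z: "\<And>x. a < x \<Longrightarrow> a < z x \<and> z x < x \<and> h x - h a = (x - a) * h' (z x)"
    by metis
  have "((\<lambda>x. (h x - h a) / (x - a)) \<longlongrightarrow> h' a) (at_right a)"
    using D[of a] by (simp add: has_field_derivative_iff at_within_Ici_at_right)
  moreover have "filterlim z (at_right a) (at_right a)"
    unfolding filterlim_at
  proof
    show "(z \<longlongrightarrow> a) (at_right a)"
    proof (rule tendsto_sandwich[of "\<lambda>x. a" z "at_right a" "\<lambda>x. x"])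
      show "\<forall>\<^sub>F x in at_right a. a \<le> z x" "\<forall>\<^sub>F x in at_right a. z x \<le> x"
        using z by (auto simp: eventually_at_filter intro!: always_eventually less_imp_le)
    qed (auto intro: tendsto_ident_at)
    show "\<forall>\<^sub>F x in at_right a. z x \<in> {a<..} \<and> z x \<noteq> a"
      using z by (auto simp: eventually_at_filter intro!: always_eventually)
  qed
  then have "((\<lambda>x. h' (z x)) \<longlongrightarrow> L) (at_right a)"
    by (rule filterlim_compose[OF lim])
  then have "((\<lambda>x. (h x - h a) / (x - a)) \<longlongrightarrow> L) (at_right a)"
    by (rule Lim_transform_eventually)
      (use z in \<open>auto simp: eventually_at_filter intro!: always_eventually\<close>)
  ultimately show ?thesis
    using tendsto_unique trivial_limit_at_right_real by blast
qed

lemma DERIV_within_scale: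
  fixes h :: "real \<Rightarrow> real"
  assumes "(h has_real_derivative D) (at (k * x) within {0..})" "k > 0"
  shows "((\<lambda>x. h (k * x)) has_real_derivative D * k) (at x within {0..})"
proof -
  have "(h \<circ> (*) k has_real_derivative D * k) (at x within {0..})"
  proof (rule DERIV_image_chain)
    show "(h has_real_derivative D) (at (k * x) within (*) k ` {0..})"
      by (rule has_field_derivative_subset[OF assms(1)]) (use \<open>k > 0\<close> in auto)
  qed (auto intro!: derivative_eq_intros)
  then show ?thesis by (simp add: o_def)
qed

lemma integral_DERIV_halfline:
  fixes g :: "real \<Rightarrow> real"
  assumes "continuous_on {0..} g" "x \<ge> 0"
  shows "((\<lambda>x. integral {0..x} g) has_real_derivative g x) (at x within {0..})"
proof -
  have "((\<lambda>x. integral {0..x} g) has_real_derivative g x) (at x within {0..x + 1})"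
    using assms by (intro integral_has_real_derivative) (auto intro: continuous_on_subset)
  moreover have "at x within {0..x + 1} = at x within {0..}"
    by (rule at_within_nhd[of _ "{..<x + 1}"]) auto
  ultimately show ?thesis by simp
qed

section \<open>Regularity and positivity of the second derivative\<close>

lemma blasius_bvp_properties:
  assumes "blasius_bvp f f1 f2 f3"
  shows "x \<ge> 0 \<Longrightarrow> (f2 has_real_derivative - (f x * f2 x)) (at x within {0..})"
    and "x \<ge> 0 \<Longrightarrow> f2 x > 0"
proof -
  have D0: "\<And>x. x \<ge> 0 \<Longrightarrow> (f has_real_derivative f1 x) (at x within {0..})"
    and D1: "\<And>x. x \<ge> 0 \<Longrightarrow> (f1 has_real_derivative f2 x) (at x within {0..})"
    and D2: "\<And>x. x > 0 \<Longrightarrow> (f2 has_real_derivative f3 x) (at x)"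
    and eq: "\<And>x. x > 0 \<Longrightarrow> f3 x = - (f x * f2 x)"
    and f10: "f1 0 = 0" and lim: "(f1 \<longlongrightarrow> 1) at_top"
    using assms by (auto simp: blasius_bvp_def add_eq_0_iff2)
  have "continuous_on {0..} f"
    using D0 by (intro DERIV_continuous_on) auto
  define g where "g x = integral {0..x} f" for x
  have Dg: "(g has_real_derivative f x) (at x within {0..})" if "x \<ge> 0" for x
    unfolding g_def[abs_def] by (rule integral_DERIV_halfline) fact+
  \<comment> \<open>The integrating factor \<open>exp (g x)\<close> makes
    \<open>f2 x * exp (g x)\<close> constant for positive \<open>x\<close>; its value is read off at
    1.\<close>
  define C where "C = f2 1 * exp (g 1)"
  have f2_open: "f2 x = C * exp (- g x)" if "x > 0" for x
  proof -
    have "((\<lambda>x. f2 x * exp (g x)) has_real_derivative 0) (at x within {0<..})" if "x \<in> {0<..}" for x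
    proof -
      have "(g has_real_derivative f x) (at x)"
        using Dg[of x] that by (simp add: at_within_Ici_interior)
      then have "((\<lambda>x. f2 x * exp (g x)) has_real_derivative 0) (at x)"
        using D2[of x] eq[of x] that by (auto intro!: derivative_eq_intros)
      then show ?thesis by (rule has_field_derivative_at_within)
    qed
    then obtain k where "\<And>x. x \<in> {0<..} \<Longrightarrow> f2 x * exp (g x) = k"
      using has_field_derivative_zero_constant[of "{0<..}" "\<lambda>x. f2 x * exp (g x)"]
        convex_real_interval(3) by blast
    then have "f2 x * exp (g x) = C" using that by (simp add: C_def)
    then show ?thesis by (simp add: exp_minus field_simps)
  qed
  have "(f2 \<longlongrightarrow> C) (at_right 0)"
  proof -
    have "(g \<longlongrightarrow> g 0) (at_right 0)"
      using DERIV_continuous[OF Dg[of 0]]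
      by (simp add: continuous_within at_within_Ici_at_right)
    then have "((\<lambda>x. C * exp (- g x)) \<longlongrightarrow> C * exp (- g 0)) (at_right 0)"
      by (intro tendsto_intros)
    then have "((\<lambda>x. C * exp (- g x)) \<longlongrightarrow> C) (at_right 0)" by (simp add: g_def)
    then show ?thesis
      by (rule Lim_transform_eventually)
        (auto simp: eventually_at_filter f2_open intro!: always_eventually)
  qed
  \<comment> \<open>Since \<open>f2\<close> is the derivative of \<open>f1\<close> on the closed
    half line, it agrees at 0 with its right limit.\<close>
  then have "f2 0 = C" by (intro DERIV_right_limit_eq[of 0 f1 f2 C] D1)
  then have f2: "f2 x = C * exp (- g x)" if "x \<ge> 0" for x
    using f2_open[of x] that by (cases "x = 0") (auto simp: g_def)
  show "(f2 has_real_derivative - (f x * f2 x)) (at x within {0..})" if "x \<ge> 0" for x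
  proof (rule has_field_derivative_transform_within[of "\<lambda>x. C * exp (- g x)" _ _ _ 1])
    show "((\<lambda>x. C * exp (- g x)) has_real_derivative - (f x * f2 x)) (at x within {0..})"
      using f2[OF that] by (auto intro!: derivative_eq_intros Dg that)
  qed (use that f2 in auto)
  \<comment> \<open>Otherwise \<open>f1\<close> could never rise above \<open>f1 0 = 0\<close>,
    against its limit 1.\<close>
  have "C > 0"
  proof (rule ccontr)
    assume "\<not> C > 0"
    have "f1 y \<le> 0" if "y \<ge> 0" for y
    proof -
      have "- f1 0 \<le> - f1 y"
      proof (rule halfline_mono[where a = 0 and h = "\<lambda>x. - f1 x" and h' = "\<lambda>x. - f2 x"])
        show "- f2 x \<ge> 0" if "x > 0" for x
          using f2[of x] that \<open>\<not> C > 0\<close> by (simp add: mult_nonpos_nonneg)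
      qed (use that D1 in \<open>auto intro: DERIV_minus\<close>)
      then show ?thesis using f10 by simp
    qed
    then have "(1::real) \<le> 0"
      by (intro tendsto_upperbound[OF lim]) (auto simp: eventually_at_top_linorder)
    then show False by simp
  qed
  then show "f2 x > 0" if "x \<ge> 0" for x using f2[OF that] by simp
qed

section \<open>The normalized initial value problem: error estimate and asymptotics\<close>

locale normalized_blasius =
  fixes F F1 F2 :: "real \<Rightarrow> real"
  assumes D0: "x \<ge> 0 \<Longrightarrow> (F has_real_derivative F1 x) (at x within {0..})"
    and D1: "x \<ge> 0 \<Longrightarrow> (F1 has_real_derivative F2 x) (at x within {0..})"
    and D2: "x \<ge> 0 \<Longrightarrow> (F2 has_real_derivative - (F x * F2 x)) (at x within {0..})"
    and init: "F 0 = 0" "F1 0 = 0" "F2 0 = 1"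
    and F2_pos: "x \<ge> 0 \<Longrightarrow> F2 x > 0"
begin

lemma F1_nonneg: "x \<ge> 0 \<Longrightarrow> F1 x \<ge> 0"
  using halfline_mono[OF D1, where b = 0 and y = x] F2_pos init by (force intro: less_imp_le)

lemma F_nonneg: "x \<ge> 0 \<Longrightarrow> F x \<ge> 0"
  using halfline_mono[OF D0, where b = 0 and y = x] F1_nonneg init by force

text \<open>Both factors of \<open>F x * F2 x\<close> are nonnegative, so \<open>F2\<close>
  decreases from its initial value. The bound caps a coefficient in the energy estimate and later
  forces \<open>F2 / F\<close> to 0.\<close>

lemma F2_le_1: "x \<ge> 0 \<Longrightarrow> F2 x \<le> 1"
proof -
  assume "x \<ge> 0"
  have "- F2 0 \<le> - F2 x"
  proof (rule halfline_mono[where a = 0 and h = "\<lambda>x. - F2 x" and h' = "\<lambda>x. F x * F2 x"])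
    show "((\<lambda>x. - F2 x) has_real_derivative F x * F2 x) (at x within {0..})" if "x \<ge> 0" for x
      using DERIV_minus[OF D2[OF that]] by simp
    show "F x * F2 x \<ge> 0" if "x > 0" for x
      using F_nonneg[of x] F2_pos[of x] that by simp
  qed (use \<open>x \<ge> 0\<close> in auto)
  then show ?thesis using init by simp
qed

text \<open>
  For \<open>E = F - P\<close> and the residual \<open>r = P''' + P P''\<close> one has \<open>E''' = - P E'' - F'' E - r\<close>.
  As \<open>P \<ge> 0\<close> the first term only damps, so the energy \<open>S = E\<^sup>2 + E'\<^sup>2 + E''\<^sup>2\<close> satisfies
  \<open>S' \<le> 9/4 S + 4 \<delta>\<^sup>2\<close>.
\<close>

lemma approximation_error:
  assumes P0: "\<And>x. (P has_real_derivative P1 x) (at x)"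
    and P1: "\<And>x. (P1 has_real_derivative P2 x) (at x)"
    and P2: "\<And>x. (P2 has_real_derivative P3 x) (at x)"
    and initP: "P 0 = 0" "P1 0 = 0" "P2 0 = 1"
    and nonneg: "\<And>x. 0 \<le> x \<Longrightarrow> x \<le> X \<Longrightarrow> P x \<ge> 0"
    and resid: "\<And>x. 0 \<le> x \<Longrightarrow> x \<le> X \<Longrightarrow> \<bar>P3 x + P x * P2 x\<bar> \<le> \<delta>"
    and "X \<ge> 0"
  shows "(F X - P X)\<^sup>2 + (F1 X - P1 X)\<^sup>2 + (F2 X - P2 X)\<^sup>2 \<le> 16 / 9 * \<delta>\<^sup>2 * exp (9 / 4 * X)"
proof -
  define S where "S x = (F x - P x)\<^sup>2 + (F1 x - P1 x)\<^sup>2 + (F2 x - P2 x)\<^sup>2" for x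
  define S' where "S' x = 2 * (F x - P x) * (F1 x - P1 x) + 2 * (F1 x - P1 x) * (F2 x - P2 x)
      + 2 * (F2 x - P2 x) * (- (F x * F2 x) - P3 x)" for x
  have DS: "(S has_real_derivative S' x) (at x within {0..})" if "x \<ge> 0" for x
    unfolding S_def[abs_def] S'_def
    by (auto intro!: derivative_eq_intros D0 D1 D2 that P0[THEN has_field_derivative_at_within]
       P1[THEN has_field_derivative_at_within] P2[THEN has_field_derivative_at_within]
       simp: algebra_simps)
  have S'_le: "S' x \<le> 9 / 4 * S x + 4 * \<delta>\<^sup>2" if "0 < x" "x < X" for x
  proof -
    define u v w r where "u = F x - P x" and "v = F1 x - P1 x" and "w = F2 x - P2 x"
      and "r = P3 x + P x * P2 x"
    have r: "\<bar>r\<bar> \<le> \<delta>" and "P x \<ge> 0" and F2: "0 \<le> F2 x" "F2 x \<le> 1"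
      using resid nonneg F2_pos[of x] F2_le_1[of x] that by (auto simp: r_def intro: less_imp_le)
    \<comment> \<open>Writing \<open>F * F2 - P * P2\<close> as \<open>u * F2 + P * w\<close> gives
      \<open>u\<close> a coefficient in [0, 1] and \<open>w\<close> a nonnegative one.\<close>
    have "- (F x * F2 x) - P3 x = - P x * w - F2 x * u - r"
      by (simp add: u_def w_def r_def algebra_simps)
    then have "S' x = 2 * u * v + 2 * v * w + 2 * w * (- P x * w - F2 x * u - r)"
      unfolding S'_def u_def v_def w_def by (simp only:)
    then have "S' x = 2 * u * v + 2 * v * w - 2 * P x * w\<^sup>2 - F2 x * (2 * (u * w)) - 2 * (w * r)"
      by (simp add: power2_eq_square algebra_simps)
    moreover have "2 * u * v \<le> u\<^sup>2 + v\<^sup>2" "2 * v * w \<le> v\<^sup>2 + w\<^sup>2"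
      by (rule sum_squares_bound)+
    moreover have "- (F2 x * (2 * (u * w))) \<le> u\<^sup>2 + w\<^sup>2"
    proof -
      have "- (2 * (u * w)) \<le> u\<^sup>2 + w\<^sup>2"
        using sum_squares_bound[of "-u" w] by simp
      then have "F2 x * (- (2 * (u * w))) \<le> F2 x * (u\<^sup>2 + w\<^sup>2)"
        using F2 by (intro mult_left_mono)
      also have "\<dots> \<le> 1 * (u\<^sup>2 + w\<^sup>2)"
        using F2 by (intro mult_right_mono) auto
      finally show ?thesis by simp
    qed
    \<comment> \<open>Weighted so that \<open>w\<close> costs only 1/4: the other three products use
      each square twice, hence the rate 2 + 1/4 = 9/4.\<close>
    moreover have "- 2 * (w * r) \<le> w\<^sup>2 / 4 + 4 * r\<^sup>2"
      using zero_le_power2[of "w / 2 + 2 * r"] by (simp add: power2_eq_square field_simps)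
    moreover have "r\<^sup>2 \<le> \<delta>\<^sup>2" using r by (metis abs_ge_zero power2_abs power_mono)
    moreover have "2 * P x * w\<^sup>2 \<ge> 0" using \<open>P x \<ge> 0\<close> by simp
    moreover have "S x = u\<^sup>2 + v\<^sup>2 + w\<^sup>2" by (simp add: S_def u_def v_def w_def)
    moreover have "u\<^sup>2 \<ge> 0" "v\<^sup>2 \<ge> 0" by simp_all
    ultimately show ?thesis by argo
  qed
  \<comment> \<open>Gronwall's argument, negated to fit \<open>halfline_mono\<close>. The shift 16/9
    is 4 divided by the rate 9/4.\<close>
  define H where "H x = - ((S x + 16 / 9 * \<delta>\<^sup>2) * exp (- (9 / 4 * x)))" for x
  have "H 0 \<le> H X"
  proof (rule halfline_mono[where a = 0 and h = H and
        h' = "\<lambda>x. (9 / 4 * S x + 4 * \<delta>\<^sup>2 - S' x) * exp (- (9 / 4 * x))"])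
    show "(H has_real_derivative (9 / 4 * S x + 4 * \<delta>\<^sup>2 - S' x) * exp (- (9 / 4 * x)))
        (at x within {0..})" if "x \<ge> 0" for x
      unfolding H_def[abs_def]
      by (auto intro!: derivative_eq_intros DS that simp: algebra_simps)
  qed (use S'_le \<open>X \<ge> 0\<close> in auto)
  moreover have "S 0 = 0" by (simp add: S_def init initP)
  ultimately have "(S X + 16 / 9 * \<delta>\<^sup>2) * exp (- (9 / 4 * X)) \<le> 16 / 9 * \<delta>\<^sup>2"
    by (simp add: H_def)
  then have "(S X + 16 / 9 * \<delta>\<^sup>2) \<le> 16 / 9 * \<delta>\<^sup>2 * exp (9 / 4 * X)"
    by (simp add: exp_minus field_simps)
  moreover have "0 \<le> 16 / 9 * \<delta>\<^sup>2" by simp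
  ultimately have "S X \<le> 16 / 9 * \<delta>\<^sup>2 * exp (9 / 4 * X)" by linarith
  then show ?thesis unfolding S_def .
qed

lemma F_mono: "0 \<le> x \<Longrightarrow> x \<le> y \<Longrightarrow> F x \<le> F y"
  using halfline_mono[OF D0, where b = x and y = y] F1_nonneg by simp

text \<open>The derivative of \<open>F2 / F\<close> is \<open>- F2 - F1 * F2 / F^2\<close>, whose
  first term cancels that of \<open>F1\<close> when \<open>k = 1\<close>. A \<open>k\<close>
  slightly below 1 reverses the sign once \<open>F1 / F^2\<close> is small.\<close>

lemma DERIV_asymptotic:
  assumes "x \<ge> 0" "F x > 0"
  shows "((\<lambda>x. F1 x + k * F2 x / F x) has_real_derivative
      F2 x * (1 - k - k * F1 x / (F x)\<^sup>2)) (at x within {0..})"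
  using assms
  by (auto intro!: derivative_eq_intros D0 D1 D2 simp: field_simps power2_eq_square)

text \<open>For \<open>k = 1\<close> the function of \<open>DERIV_asymptotic\<close> decreases and
  dominates \<open>F1\<close>, which gives the upper bound. As \<open>F1\<close> stays below that
  bound and \<open>F\<close> does not decrease, the condition on \<open>k\<close> at
  \<open>X\<close> persists beyond \<open>X\<close>; the function then increases to
  \<open>a\<close>.\<close>

lemma limit_bounds:
  assumes lim: "(F1 \<longlongrightarrow> a) at_top" and X: "X \<ge> 0" "F X > 0"
  shows "a \<le> F1 X + F2 X / F X"
    and "F1 X > 0 \<Longrightarrow> 0 \<le> k \<Longrightarrow>
      k * (1 + (F1 X + F2 X / F X) / (F X)\<^sup>2) \<le> 1 \<Longrightarrow> F1 X + k * F2 X / F X \<le> a"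
proof -
  have F_ge: "F x \<ge> F X" "F x > 0" if "x \<ge> X" for x
    using F_mono[of X x] that X by auto
  have D: "((\<lambda>x. F1 x + k * F2 x / F x) has_real_derivative
      F2 x * (1 - k - k * F1 x / (F x)\<^sup>2)) (at x within {X..})" if "x \<ge> X" for x k
    by (rule has_field_derivative_subset[OF DERIV_asymptotic]) (use F_ge[OF that] that X in auto)
  have dec: "F1 x + F2 x / F x \<le> F1 X + F2 X / F X" if "x \<ge> X" for x
  proof -
    have "- (F1 X + 1 * F2 X / F X) \<le> - (F1 x + 1 * F2 x / F x)"
    proof (rule halfline_mono[where a = X and h = "\<lambda>x. - (F1 x + 1 * F2 x / F x)"])
      show "((\<lambda>x. - (F1 x + 1 * F2 x / F x)) has_real_derivative
          - (F2 x * (1 - 1 - 1 * F1 x / (F x)\<^sup>2))) (at x within {X..})" if "x \<ge> X" for x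
        by (intro DERIV_minus D that)
      show "- (F2 x * (1 - 1 - 1 * F1 x / (F x)\<^sup>2)) \<ge> 0" if "x > X" for x
        using F1_nonneg[of x] F2_pos[of x] that X by simp
    qed (use that in auto)
    then show ?thesis by simp
  qed
  have quotient_nonneg: "F2 x / F x \<ge> 0" if "x \<ge> X" for x
    using F_ge[OF that] F2_pos[of x] that X by simp
  have F1_le: "F1 x \<le> F1 X + F2 X / F X" if "x \<ge> X" for x
    using dec[OF that] quotient_nonneg[OF that] by simp
  show "a \<le> F1 X + F2 X / F X"
    by (rule tendsto_upperbound[OF lim]) (auto simp: eventually_at_top_linorder intro!: F1_le)
  assume k: "F1 X > 0" "0 \<le> k" "k * (1 + (F1 X + F2 X / F X) / (F X)\<^sup>2) \<le> 1"
  have inc: "F1 X + k * F2 X / F X \<le> F1 x + k * F2 x / F x" if "x \<ge> X" for x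
  proof (rule halfline_mono[where a = X and h = "\<lambda>x. F1 x + k * F2 x / F x"])
    show "((\<lambda>x. F1 x + k * F2 x / F x) has_real_derivative
        F2 x * (1 - k - k * F1 x / (F x)\<^sup>2)) (at x within {X..})" if "x \<ge> X" for x
      by (rule D[OF that])
    show "F2 x * (1 - k - k * F1 x / (F x)\<^sup>2) \<ge> 0" if "x > X" for x
    proof -
      have "F1 x / (F x)\<^sup>2 \<le> (F1 X + F2 X / F X) / (F X)\<^sup>2"
        using F_ge[of x] F1_le[of x] F1_nonneg[of x] that X
        by (intro frac_le) (auto intro: power_mono)
      then have "k * (F1 x / (F x)\<^sup>2) \<le> k * ((F1 X + F2 X / F X) / (F X)\<^sup>2)"
        using k by (intro mult_left_mono)
      then have "1 - k - k * F1 x / (F x)\<^sup>2 \<ge> 0" using k(3) by (simp add: algebra_simps)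
      then show ?thesis using F2_pos[of x] that X by simp
    qed
  qed (use that in auto)
  \<comment> \<open>\<open>F2\<close> stays in [0, 1], while \<open>F\<close> grows at least
    linearly with slope \<open>F1 X\<close>.\<close>
  have "((\<lambda>x. F2 x / F x) \<longlongrightarrow> 0) at_top"
  proof (rule tendsto_sandwich[where f = "\<lambda>_. 0" and h = "\<lambda>x. inverse (F x)"])
    have F_linear: "F1 X * (x - X) \<le> F x" if "x \<ge> X" for x
    proof -
      have "F X - F1 X * X \<le> F x - F1 X * x"
      proof (rule halfline_mono[where a = X and h = "\<lambda>x. F x - F1 X * x"])
        show "((\<lambda>x. F x - F1 X * x) has_real_derivative F1 x - F1 X) (at x within {X..})"
          if "x \<ge> X" for x
          by (rule has_field_derivative_subset[of _ _ _ "{0..}"])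
            (use that X in \<open>auto intro!: derivative_eq_intros D0\<close>)
        show "F1 x - F1 X \<ge> 0" if "x > X" for x
          using halfline_mono[OF D1, where b = X and y = x] F2_pos that X by (force intro: less_imp_le)
      qed (use that in auto)
      then show ?thesis using X by (simp add: algebra_simps)
    qed
    have "filterlim (\<lambda>x. F1 X * (- X + x)) at_top at_top"
      by (intro filterlim_tendsto_pos_mult_at_top[OF tendsto_const k(1)]
          filterlim_tendsto_add_at_top[OF tendsto_const] filterlim_ident)
    then have "filterlim (\<lambda>x. F1 X * (x - X)) at_top at_top" by simp
    then have "filterlim F at_top at_top"
      by (rule filterlim_at_top_mono)
        (auto simp: eventually_at_top_linorder intro!: exI[of _ X] F_linear)
    then show "((\<lambda>x. inverse (F x)) \<longlongrightarrow> 0) at_top"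
      by (rule tendsto_inverse_0_at_top)
    show "\<forall>\<^sub>F x in at_top. 0 \<le> F2 x / F x"
      using quotient_nonneg by (auto simp: eventually_at_top_linorder)
    show "\<forall>\<^sub>F x in at_top. F2 x / F x \<le> inverse (F x)"
      using F_ge F2_le_1 X
      by (auto simp: eventually_at_top_linorder field_simps intro!: exI[of _ X])
  qed simp
  then have "((\<lambda>x. F1 x + k * (F2 x / F x)) \<longlongrightarrow> a + k * 0) at_top"
    by (intro tendsto_intros lim)
  then show "F1 X + k * F2 X / F X \<le> a"
    by (intro tendsto_lowerbound[of "\<lambda>x. F1 x + k * (F2 x / F x)" _ at_top])
      (use inc in \<open>auto simp: eventually_at_top_linorder\<close>)
qed

end

section \<open>Integer polynomials and Chebyshev sums\<close>

text \<open>Integer coefficients, constant term first, let concrete polynomial identities be checked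
  by evaluating lists.\<close>

fun list_poly :: "int list \<Rightarrow> real \<Rightarrow> real" where
  "list_poly [] t = 0"
| "list_poly (c # cs) t = of_int c + t * list_poly cs t"

fun list_add :: "int list \<Rightarrow> int list \<Rightarrow> int list" where
  "list_add [] ys = ys"
| "list_add xs [] = xs"
| "list_add (x # xs) (y # ys) = (x + y) # list_add xs ys"

definition list_smult :: "int \<Rightarrow> int list \<Rightarrow> int list" where
  "list_smult c xs = map ((*) c) xs"

fun list_mult :: "int list \<Rightarrow> int list \<Rightarrow> int list" where
  "list_mult [] ys = []"
| "list_mult (x # xs) ys = list_add (list_smult x ys) (0 # list_mult xs ys)"

text \<open>The product rule for the Horner form \<open>c + t * p\<close>, free of index
  factors.\<close>

fun list_deriv :: "int list \<Rightarrow> int list" where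
  "list_deriv [] = []"
| "list_deriv (c # cs) = list_add cs (0 # list_deriv cs)"

lemma list_poly_add [simp]: "list_poly (list_add xs ys) t = list_poly xs t + list_poly ys t"
  by (induction xs ys rule: list_add.induct) (auto simp: algebra_simps)

lemma list_poly_smult [simp]: "list_poly (list_smult c xs) t = of_int c * list_poly xs t"
  by (induction xs) (auto simp: list_smult_def algebra_simps)

lemma list_poly_mult [simp]: "list_poly (list_mult xs ys) t = list_poly xs t * list_poly ys t"
  by (induction xs) (auto simp: algebra_simps)

lemma DERIV_list_poly: "(list_poly xs has_real_derivative list_poly (list_deriv xs) t) (at t)"
proof (induction xs)
  case (Cons c cs)
  have "((\<lambda>t. of_int c + t * list_poly cs t) has_real_derivative
      list_poly cs t + t * list_poly (list_deriv cs) t) (at t)"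
    by (auto intro!: derivative_eq_intros Cons.IH)
  then show ?case by simp
qed simp

text \<open>
  Clenshaw's recurrence for \<open>\<Sum> c\<^sub>k T\<^sub>k(1 - 2t)\<close>, with polynomials in \<open>t\<close> as coefficient lists.
\<close>

fun clenshaw :: "int list \<Rightarrow> int list \<times> int list" where
  "clenshaw [] = ([], [])"
| "clenshaw (c # cs) = (case clenshaw cs of (p, q) \<Rightarrow>
     (list_add [c] (list_add (list_smult 2 p)
        (list_add (0 # list_smult (- 4) p) (list_smult (- 1) q))), p))"

text \<open>Clenshaw's closing step \<open>p - (1 - 2 * t) * q\<close>.\<close>

definition chebyshev_sum :: "int list \<Rightarrow> int list" where
  "chebyshev_sum cs = (case clenshaw cs of (p, q) \<Rightarrow>
     list_add p (list_add (list_smult (- 1) q) (0 # list_smult 2 q)))"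

text \<open>A Chebyshev sum seen through T_k(cos y) = cos(k y). The running index \<open>n\<close>
  makes the tail of the list an instance again, as the inductions require.\<close>

primrec cos_sum :: "real \<Rightarrow> int list \<Rightarrow> real \<Rightarrow> real" where
  "cos_sum y [] n = 0"
| "cos_sum y (c # cs) n = of_int c * cos (n * y) + cos_sum y cs (n + 1)"

lemma abs_cos_sum_le: "\<bar>cos_sum y cs n\<bar> \<le> of_int (\<Sum>c\<leftarrow>cs. \<bar>c\<bar>)"
proof (induction cs arbitrary: n)
  case (Cons c cs)
  have "\<bar>of_int c * cos (n * y)\<bar> \<le> \<bar>of_int c\<bar>"
    by (simp add: abs_mult mult_left_le)
  then show ?case using Cons.IH[of "n + 1"] by simp
qed simp

text \<open>Expanding \<open>cos ((n + 1) * y)\<close> by the three-term recurrence is exactly one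
  Clenshaw step.\<close>

lemma cos_sum_clenshaw:
  assumes "cos y = 1 - 2 * t"
  shows "cos_sum y cs n =
    list_poly (fst (clenshaw cs)) t * cos (n * y)
      - list_poly (snd (clenshaw cs)) t * cos ((n - 1) * y)"
proof (induction cs arbitrary: n)
  case (Cons c cs)
  have eq: "cos ((n + 1) * y) = 2 * (1 - 2 * t) * cos (n * y) - cos ((n - 1) * y)"
    unfolding assms[symmetric] by (simp add: ring_distribs cos_add cos_diff)
  obtain p q where "clenshaw cs = (p, q)" by fastforce
  then show ?case
    unfolding cos_sum.simps Cons.IH eq by (simp add: algebra_simps)
qed simp

lemma cos_sum_chebyshev:
  assumes "cos y = 1 - 2 * t"
  shows "list_poly (chebyshev_sum cs) t = cos_sum y cs 0"
  unfolding cos_sum_clenshaw[OF assms]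
  by (simp add: chebyshev_sum_def assms algebra_simps split: prod.split)

text \<open>A positivity certificate: every T_k is bounded by 1 on [-1, 1], so the constant
  coefficient only has to outweigh the others.\<close>

lemma chebyshev_sum_Cons_ge:
  assumes "0 \<le> t" "t \<le> 1"
  shows "of_int (c - (\<Sum>c\<leftarrow>cs. \<bar>c\<bar>)) \<le> list_poly (chebyshev_sum (c # cs)) t"
proof -
  have "cos (arccos (1 - 2 * t)) = 1 - 2 * t"
    using assms by (intro cos_arccos) auto
  then show ?thesis
    using cos_sum_chebyshev[of _ t "c # cs"] abs_cos_sum_le[of "arccos (1 - 2 * t)" cs 1] by simp
qed

lemma abs_chebyshev_sum_le:
  assumes "0 \<le> t" "t \<le> 1"
  shows "\<bar>list_poly (chebyshev_sum cs) t\<bar> \<le> of_int (\<Sum>c\<leftarrow>cs. \<bar>c\<bar>)"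
proof -
  have "cos (arccos (1 - 2 * t)) = 1 - 2 * t"
    using assms by (intro cos_arccos) auto
  then show ?thesis using cos_sum_chebyshev abs_cos_sum_le by metis
qed

section \<open>The polynomial approximation and its certificates\<close>

text \<open>
  The approximate solution on \<open>[0, 4]\<close> is \<open>P(4t) = 10\<^sup>-\<^sup>1\<^sup>0 t\<^sup>2 \<Sum> c\<^sub>k t\<^sup>k\<close> with the integer coefficients
  \<open>c\<^sub>k\<close> below. They come from a Chebyshev interpolant of the numerically computed \<open>F'''\<close>,
  integrated three times.
\<close>

definition approx_quot :: "int list" where
  "approx_quot =
     [80000000000, 5392, -1189734, -85263333911, -2049451992, 36372405570, -253681108065,
     3658538237957, -22896346894550, 108418805365274, -399523964494892, 1145342318919564,
     -2575629256189145, 4548097506195116, -6270311122658574, 6686855398526257,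
     -5444352580921030, 3317453964297324, -1464362345323632, 442404872117475, -81889824586679,
     7009213406637]"

definition approx :: "int list" where "approx = 0 # 0 # approx_quot"

text \<open>The degree is 21 and T_21(1 - 2t) has leading coefficient -2^41, so the factor
  \<open>2 ^ 41\<close> makes all Chebyshev coefficients integers.\<close>

lemma approx_quot_chebyshev:
  "list_smult (2 ^ 41) approx_quot = chebyshev_sum
     [149875347201169509424796, 34613963442215409159828, -6861294646070200472336,
     -2580851806798953481458, 540266276592836717420, 382005283081618749030,
     -7026735766871309280, -42391437924986366136, -3059053933522220432, 4659246095434353160,
     773422691257130400, -461302827436427225, -123250323464159474, 41970794731313339,
     16845362031424136, -3310496826296450, -2078207849054988, 197238248849054, 232489344466632,
     -11038763125417, -33172335267962, -7009213406637]"
  by code_simp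

text \<open>
  The two trailing zeros match the length of the left-hand side: \<open>list_deriv\<close> preserves the
  length of its argument.
\<close>

lemma approx_residual_chebyshev:
  "list_smult (2 ^ 84) (list_add (list_smult (10 ^ 10) (list_deriv (list_deriv (list_deriv approx))))
     (list_smult 4 (list_mult approx (list_deriv (list_deriv approx))))) =
   chebyshev_sum
     [-335458888448111234276686343866542178924, 568181614356267159983805294779548312672,
     -389156943223648641801849108781720801808, 254400172465017737698854875622556350624,
     -143598243922358603121015524218247861362, 61833992499954136899642799551458216112,
     -22062867940929886218642068328491501528, 6083030532662015802526777746069505232,
     -414242549504398602695087913813228524, -748221306808959211057851701443038832,
     271842907617983276991612743229280328, 700903133807342663230889823940924912,
     996276319039262013202654113654635394, -4760559014614923736610633315404505024,
     -9734348985183446357030320699041082016, 25405288559493131276795392489653293504,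
     82027215617415846165881692165162915664, -115402670492538724867203253653142972480,
     -582124222481119879696283317596365048224, 658436340641657964650009700158447970880,
     2925163972983465553523531136128279008265, 174483955123506873050653891685292592536,
     3423914723487555343493082424042592305812, -40483014032269536070619039312899933400,
     -254435361095795690800860347733450523150, -51496685945664502691771578818052491576,
     20274535971014748201716233850971791748, 7882190876593394257281924398526235896,
     -1550607652550547368731366041236497537, -1034015488942886604180976932415829264,
     83808244744459220413999500374355048, 120173996275408209815078054757109904,
     179540020440118863429104217803036, -12766817211895093286778022089051760,
     -952650303916003413758490040999448, 1232924597444172966284756903207408,
     181728079100635571396651272303907, -106788389439141030525945338627752,
     -24459963550323477689359926848556, 7992081583144443011137663546728,
     2656358324022803506250609319930, -475082515938537245450463997368,
     -228486352701652543084519082076, 17421912396940002574405723512,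
     12429655362684304255059391557, 0, 0]"
  by code_simp

text \<open>The double zero of \<open>approx\<close> at 0 is split off, since there the certificate
  could never have a positive margin; for the quotient the margin is ample.\<close>

lemma approx_quot_nonneg:
  assumes "0 \<le> t" "t \<le> 1"
  shows "list_poly approx_quot t \<ge> 0"
proof -
  have "0 \<le> list_poly (list_smult (2 ^ 41) approx_quot) t"
    unfolding approx_quot_chebyshev
    by (rule order_trans[OF _ chebyshev_sum_Cons_ge[OF assms]]) simp
  then show ?thesis by (simp add: zero_le_mult_iff)
qed

text \<open>This is the residual in \<open>x = 4 * t\<close> times \<open>64 * 10 ^ 20\<close>,
  which clears the chain rule factors and the scale \<open>10 ^ 10\<close>. The value
  \<open>83 / 10 ^ 9\<close> is the Chebyshev coefficient sum rounded up.\<close>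

lemma approx_residual:
  assumes "0 \<le> t" "t \<le> 1"
  shows "\<bar>10 ^ 10 * list_poly (list_deriv (list_deriv (list_deriv approx))) t
      + 4 * (list_poly approx t * list_poly (list_deriv (list_deriv approx)) t)\<bar>
    \<le> 64 * 10 ^ 20 * (83 / 10 ^ 9)"
proof -
  have "\<bar>list_poly (list_smult (2 ^ 84) (list_add
        (list_smult (10 ^ 10) (list_deriv (list_deriv (list_deriv approx))))
        (list_smult 4 (list_mult approx (list_deriv (list_deriv approx)))))) t\<bar>
      \<le> 2 ^ 84 * (64 * 10 ^ 20 * (83 / 10 ^ 9))"
    unfolding approx_residual_chebyshev
    by (rule order_trans[OF abs_chebyshev_sum_le[OF assms]]) simp
  then show ?thesis by (simp add: abs_mult)
qed

lemma approx_values: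
  "list_poly approx 0 = 0" "list_poly (list_deriv approx) 0 = 0"
  "list_poly (list_deriv (list_deriv approx)) 0 = 16 * 10 ^ 10"
  "list_poly approx 1 \<in> {5.0553 * 10 ^ 10..5.0554 * 10 ^ 10}"
  "list_poly (list_deriv approx) 1 \<in> {4 * 1.655131 * 10 ^ 10..4 * 1.655132 * 10 ^ 10}"
  "list_poly (list_deriv (list_deriv approx)) 1
    \<in> {16 * 0.000312 * 10 ^ 10..16 * 0.000313 * 10 ^ 10}"
  by (simp_all add: approx_def approx_quot_def)

section \<open>Numerical enclosure at 4 and of the limit\<close>

context normalized_blasius
begin

lemma values_at_4:
  "F 4 \<in> {5.05..5.06}" "F1 4 \<in> {1.65512..1.655143}" "F2 4 \<in> {0.000301..0.000324}"
proof -
  \<comment> \<open>With \<open>l\<close> the \<open>k\<close>-th \<open>list_deriv\<close> of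
    \<open>approx\<close>, this is the \<open>k\<close>-th derivative in \<open>x\<close>;
    \<open>t = x / 4\<close> contributes \<open>4 ^ k\<close>.\<close>
  define P where "P k l x = list_poly l (x / 4) / (4 ^ k * 10 ^ 10)" for k :: nat and l x
  let ?l0 = approx
  let ?l1 = "list_deriv ?l0"
  let ?l2 = "list_deriv ?l1"
  let ?l3 = "list_deriv ?l2"
  have D: "(P k l has_real_derivative P (Suc k) (list_deriv l) x) (at x)" for k l x
  proof -
    have "((\<lambda>x. list_poly l (x / 4)) has_real_derivative
        list_poly (list_deriv l) (x / 4) * (1 / 4)) (at x)"
      by (rule DERIV_chain2[OF DERIV_list_poly]) (auto intro!: derivative_eq_intros)
    from DERIV_cdivide[OF this, of "4 ^ k * 10 ^ 10"] show ?thesis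
      by (simp add: P_def[abs_def] mult_ac)
  qed
  have error: "(F 4 - P 0 ?l0 4)\<^sup>2 + (F1 4 - P 1 ?l1 4)\<^sup>2 + (F2 4 - P 2 ?l2 4)\<^sup>2
      \<le> 16 / 9 * (83 / 10 ^ 9)\<^sup>2 * exp (9 / 4 * 4)"
  proof (rule approximation_error)
    show "(P 0 ?l0 has_real_derivative P 1 ?l1 x) (at x)"
      "(P 1 ?l1 has_real_derivative P 2 ?l2 x) (at x)"
      "(P 2 ?l2 has_real_derivative P 3 ?l3 x) (at x)" for x
      using D[of 0 ?l0 x] D[of 1 ?l1 x] D[of 2 ?l2 x] by (simp_all add: numeral_eq_Suc)
    show "P 0 ?l0 0 = 0" "P 1 ?l1 0 = 0" "P 2 ?l2 0 = 1"
      by (simp_all add: P_def approx_values)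
    fix x :: real assume x: "0 \<le> x" "x \<le> 4"
    then show "P 0 ?l0 x \<ge> 0"
      using approx_quot_nonneg[of "x / 4"] by (simp add: P_def approx_def)
    have eq: "P 3 ?l3 x + P 0 ?l0 x * P 2 ?l2 x = (10 ^ 10 * list_poly ?l3 (x / 4)
        + 4 * (list_poly ?l0 (x / 4) * list_poly ?l2 (x / 4))) / (64 * 10 ^ 20)"
      by (simp add: P_def field_simps)
    show "\<bar>P 3 ?l3 x + P 0 ?l0 x * P 2 ?l2 x\<bar> \<le> 83 / 10 ^ 9"
      unfolding eq using approx_residual[of "x / 4"] x by (simp add: divide_le_eq)
  qed simp
  \<comment> \<open>The exponent is the integer 9, so a bound on e suffices. The resulting error in
    each of \<open>F\<close>, \<open>F1\<close>, \<open>F2\<close> at 4 is at most 0.000011.\<close>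
  have "exp (9 / 4 * 4 :: real) = exp 1 ^ 9"
    by (simp flip: exp_of_nat_mult)
  also have "\<dots> \<le> (272 / 100) ^ 9"
    using e_less_272 by (intro power_mono) auto
  finally have "16 / 9 * (83 / 10 ^ 9)\<^sup>2 * exp (9 / 4 * 4 :: real)
      \<le> 16 / 9 * (83 / 10 ^ 9)\<^sup>2 * (272 / 100) ^ 9"
    by (intro mult_left_mono) auto
  also have "\<dots> \<le> (0.000011 :: real)\<^sup>2"
    by (simp add: power2_eq_square power_divide)
  finally have "(F 4 - P 0 ?l0 4)\<^sup>2 + (F1 4 - P 1 ?l1 4)\<^sup>2 + (F2 4 - P 2 ?l2 4)\<^sup>2 \<le> 0.000011\<^sup>2"
    using error by linarith
  moreover have "(F 4 - P 0 ?l0 4)\<^sup>2 \<ge> 0" "(F1 4 - P 1 ?l1 4)\<^sup>2 \<ge> 0" "(F2 4 - P 2 ?l2 4)\<^sup>2 \<ge> 0"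
    by simp_all
  ultimately have "(F 4 - P 0 ?l0 4)\<^sup>2 \<le> 0.000011\<^sup>2" "(F1 4 - P 1 ?l1 4)\<^sup>2 \<le> 0.000011\<^sup>2"
    "(F2 4 - P 2 ?l2 4)\<^sup>2 \<le> 0.000011\<^sup>2"
    by linarith+
  then have "\<bar>F 4 - P 0 ?l0 4\<bar> \<le> 0.000011" "\<bar>F1 4 - P 1 ?l1 4\<bar> \<le> 0.000011"
    "\<bar>F2 4 - P 2 ?l2 4\<bar> \<le> 0.000011"
    by (simp_all flip: abs_le_square_iff)
  then show "F 4 \<in> {5.05..5.06}" "F1 4 \<in> {1.65512..1.655143}" "F2 4 \<in> {0.000301..0.000324}"
    using approx_values(4-6) unfolding abs_le_iff by (auto simp: P_def)
qed

lemma limit_enclosure: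
  assumes "(F1 \<longlongrightarrow> a) at_top"
  shows "a \<in> {1.65517..1.65521}"
proof -
  note v = values_at_4[unfolded atLeastAtMost_iff]
  have "F 4 > 0" "F1 4 > 0" using v by auto
  have q: "F2 4 / F 4 \<le> 0.000324 / 5.05" "0.000301 / 5.06 \<le> F2 4 / F 4"
    using v by (intro frac_le; simp)+
  have "a \<le> F1 4 + F2 4 / F 4"
    using limit_bounds(1)[OF assms] \<open>F 4 > 0\<close> by simp
  also have "\<dots> \<le> 1.65521" using q v by simp
  finally have upper: "a \<le> 1.65521" .
  have "(F1 4 + F2 4 / F 4) / (F 4)\<^sup>2 \<le> 1.65521 / 5.05\<^sup>2"
  proof (rule frac_le)
    show "F1 4 + F2 4 / F 4 \<le> 1.65521" using q v by simp
    show "5.05\<^sup>2 \<le> (F 4)\<^sup>2" using v by (intro power_mono) auto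
  qed auto
  also have "\<dots> \<le> 1 / 9" by (simp add: power2_eq_square)
  \<comment> \<open>\<open>k = 0.9\<close> is admissible because 0.9 * (1 + 1/9) = 1. As
    \<open>F2 4 / F 4\<close> is below 0.00007, using 0.9 instead of 1 costs less than
    0.000007.\<close>
  finally have "0.9 * (1 + (F1 4 + F2 4 / F 4) / (F 4)\<^sup>2) \<le> 0.9 * (1 + 1 / 9)"
    by (intro mult_left_mono add_left_mono) auto
  then have "F1 4 + 0.9 * F2 4 / F 4 \<le> a"
    using limit_bounds(2)[OF assms, of 4 "0.9"] \<open>F 4 > 0\<close> \<open>F1 4 > 0\<close> by simp
  moreover have "1.65517 \<le> F1 4 + 0.9 * F2 4 / F 4" using q v by simp
  ultimately show ?thesis using upper by simp
qed

end

section \<open>Return to the boundary value problem\<close>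

text \<open>Scaling symmetry: both terms of the equation pick up the factor
  \<open>1 / c ^ 4\<close>, and the cube root makes the second derivative at 0 equal to 1.\<close>

lemma blasius_bvp_normalize:
  assumes "blasius_bvp f f1 f2 f3"
  defines "c \<equiv> root 3 (f2 0)"
  shows "c > 0" "c ^ 3 = f2 0"
    and "normalized_blasius (\<lambda>x. f (1 / c * x) / c) (\<lambda>x. f1 (1 / c * x) / c\<^sup>2)
      (\<lambda>x. f2 (1 / c * x) / c ^ 3)"
    and "((\<lambda>x. f1 (1 / c * x) / c\<^sup>2) \<longlongrightarrow> 1 / c\<^sup>2) at_top"
proof -
  note props = blasius_bvp_properties[OF assms(1)]
  have D0: "\<And>x. x \<ge> 0 \<Longrightarrow> (f has_real_derivative f1 x) (at x within {0..})"
    and D1: "\<And>x. x \<ge> 0 \<Longrightarrow> (f1 has_real_derivative f2 x) (at x within {0..})"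
    and init: "f 0 = 0" "f1 0 = 0" and lim: "(f1 \<longlongrightarrow> 1) at_top"
    using assms by (auto simp: blasius_bvp_def)
  have "f2 0 > 0" by (simp add: props)
  then show "c > 0" and c3: "c ^ 3 = f2 0"
    by (simp_all add: c_def)
  have scale: "((\<lambda>x. h (1 / c * x) / d) has_real_derivative D * (1 / c) / d) (at x within {0..})"
    if "\<And>x. x \<ge> 0 \<Longrightarrow> (h has_real_derivative h' x) (at x within {0..})" "x \<ge> 0"
      "D = h' (1 / c * x)"
    for h h' d D and x :: real
    using that \<open>c > 0\<close> by (intro DERIV_cdivide DERIV_within_scale) auto
  show "normalized_blasius (\<lambda>x. f (1 / c * x) / c) (\<lambda>x. f1 (1 / c * x) / c\<^sup>2)
      (\<lambda>x. f2 (1 / c * x) / c ^ 3)"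
  proof
    fix x :: real assume "x \<ge> 0"
    show "((\<lambda>x. f (1 / c * x) / c) has_real_derivative f1 (1 / c * x) / c\<^sup>2) (at x within {0..})"
      using scale[OF D0 \<open>x \<ge> 0\<close> refl, of c] by (simp add: power2_eq_square)
    show "((\<lambda>x. f1 (1 / c * x) / c\<^sup>2) has_real_derivative f2 (1 / c * x) / c ^ 3) (at x within {0..})"
      using scale[OF D1 \<open>x \<ge> 0\<close> refl, of "c\<^sup>2"] by (simp add: power2_eq_square power3_eq_cube mult_ac)
    show "((\<lambda>x. f2 (1 / c * x) / c ^ 3) has_real_derivative
        - (f (1 / c * x) / c * (f2 (1 / c * x) / c ^ 3))) (at x within {0..})"
      using scale[OF props(1) \<open>x \<ge> 0\<close> refl, of "c ^ 3"] by simp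
    show "f2 (1 / c * x) / c ^ 3 > 0"
      using props(2)[of "1 / c * x"] \<open>c > 0\<close> \<open>x \<ge> 0\<close> by simp
  qed (use init c3 \<open>f2 0 > 0\<close> in auto)
  have "filterlim (\<lambda>x. 1 / c * x) at_top at_top"
    using \<open>c > 0\<close> by (intro filterlim_tendsto_pos_mult_at_top[OF tendsto_const] filterlim_ident) auto
  then have "((\<lambda>x. f1 (1 / c * x)) \<longlongrightarrow> 1) at_top"
    by (rule filterlim_compose[OF lim])
  then show "((\<lambda>x. f1 (1 / c * x) / c\<^sup>2) \<longlongrightarrow> 1 / c\<^sup>2) at_top"
    using \<open>c > 0\<close> by (intro tendsto_intros) auto
qed

theorem mainTheorem2:
  fixes f f1 f2 f3 :: "real \<Rightarrow> real"
  assumes "blasius_bvp f f1 f2 f3"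
  shows "\<bar>f2 0 - 0.469600\<bar> \<le> 0.000022"
proof -
  define c where "c = root 3 (f2 0)"
  note n = blasius_bvp_normalize[OF assms, folded c_def]
  define a where "a = 1 / c\<^sup>2"
  have "a \<in> {1.65517..1.65521}"
    unfolding a_def by (rule normalized_blasius.limit_enclosure[OF n(3,4)])
  then have a3: "1.65517 ^ 3 \<le> a ^ 3" "a ^ 3 \<le> 1.65521 ^ 3"
    by (auto intro!: power_mono)
  have pos: "f2 0 > 0" using n(1,2) by (metis zero_less_power)
  \<comment> \<open>The factors are \<open>c ^ 6\<close> and \<open>1 / c ^ 6\<close>; squaring
    avoids the power 3/2.\<close>
  have "(f2 0)\<^sup>2 * a ^ 3 = 1"
    using n(1) unfolding a_def n(2)[symmetric] by (simp add: power_divide flip: power_mult)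
  moreover have "(f2 0)\<^sup>2 * 1.65517 ^ 3 \<le> (f2 0)\<^sup>2 * a ^ 3"
    "(f2 0)\<^sup>2 * a ^ 3 \<le> (f2 0)\<^sup>2 * 1.65521 ^ 3"
    using a3 by (intro mult_left_mono; simp)+
  ultimately have sq: "(f2 0)\<^sup>2 \<le> 1 / 1.65517 ^ 3" "1 / 1.65521 ^ 3 \<le> (f2 0)\<^sup>2"
    by (auto simp: field_simps)
  have "(f2 0)\<^sup>2 \<le> 0.469622\<^sup>2" "0.469578\<^sup>2 \<le> (f2 0)\<^sup>2"
    by (rule order_trans[OF sq(1)] order_trans[OF _ sq(2)]; simp add: field_simps)+
  then have "f2 0 \<le> 0.469622" "0.469578 \<le> f2 0"
    using pos by (auto dest!: power2_le_imp_le)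
  then show ?thesis unfolding abs_le_iff by simp
qed

end
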